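(* Let $(\mu_1,\dots,\mu_r)$ be a perfect system of bidimensional measures, absolutely continuous with respect to a common measure $\mu$. Let $\vec n=(n_1,\dots,n_r)\in\mathbb{N}^r$, with associated degree and remainder $d_{\vec n},k_{\vec n}$ and associated bivariate Type I function $Q_{\vec n}$. (1) Let $\{\vec m_k:\ k=|\vec n|-d_{\vec n},\dots,|\vec n|+(d_{\vec n}+1)r\}$ be a path of neighbour multi-indices with $|\vec m_k|=k$, $\vec m_{|\vec n|}=\vec n$ and $\vec m_{|\vec n|+(d_{\vec n}+1)r}=(n_1+d_{\vec n}+1,\dots,n_r+d_{\vec n}+1)$. For every $k$ let $Q_{\vec m_k}$ be the bivariate Type I function and $P_{\vec m_k}$ the bivariate Type II multiple orthogonal polynomial associated to $\vec m_k$. Then $$xQ_{\vec n}(x,y)=Q_{\vec m_{|\vec n|-d_{\vec n}}}(x,y)+\sum_{k=|\vec n|-d_{\vec n}+1}^{|\vec n|+(d_{\vec n}+1)r}\tilde a_kQ_{\vec m_k}(x,y),$$ where $\tilde a_{k+1}=\langle xQ_{\vec n},P_{\vec m_k}\rangle_\mu$, $k=|\vec n|-d_{\vec n},\dots,|\vec n|+(d_{\vec n}+1)r-1$. (2) Let $\{\vec m_k:\ k=|\vec n|-(d_{\vec n}+1),\dots,|\vec n|+(d_{\vec n}+2)r\}$ be a path of neighbour multi-indices with $|\vec m_k|=k$, $\vec m_{|\vec n|}=\vec n$ and $\vec m_{|\vec n|+(d_{\vec n}+2)r}=(n_1+d_{\vec n}+2,\dots,n_r+d_{\vec n}+2)$.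 For every $k$ let $Q_{\vec m_k}$ be the bivariate Type I function and $P_{\vec m_k}$ the bivariate Type II multiple orthogonal polynomial associated to $\vec m_k$. Then $$yQ_{\vec n}(x,y)=Q_{\vec m_{|\vec n|-(d_{\vec n}+1)}}(x,y)+\sum_{k=|\vec n|-d_{\vec n}}^{|\vec n|+(d_{\vec n}+2)r}\tilde b_kQ_{\vec m_k}(x,y),$$ where $\tilde b_{k+1}=\langle yQ_{\vec n},P_{\vec m_k}\rangle_\mu$, $k=|\vec n|-d_{\vec n}-1,\dots,|\vec n|+(d_{\vec n}+2)r-1$.
   Context: Here $\mathbb{N}=\{0,1,2,\dots\}$ and $|\vec n|=n_1+\dots+n_r$. All measures on $\mathbb{R}^2$ are assumed to have finite moments; $d\mu_j=w_j\,d\mu$, $\langle f,g\rangle_j=\int fg\,d\mu_j$ and $\langle f,g\rangle_\mu=\int fg\,d\mu$. The Cantor pairing function is the bijection $\pi:\mathbb{N}^2\to\mathbb{N}$, $\pi(t,s)=\frac12(t+s)(t+s+1)+s$, giving the position (starting at $0$) of $x^ty^s$ in the list $1,x,y,x^2,xy,y^2,\dots$. Write $e_k(x,y)=x^ty^s$ with $(t,s)=\pi^{-1}(k)$. Degree and remainder: if $(l,m)=\pi^{-1}(|\vec n|)$, then $d_{\vec n}=l+m$ and $k_{\vec n}=|\vec n|-\frac12d_{\vec n}(d_{\vec n}+1)=m$. Type II: the bivariate Type II multiple orthogonal polynomial associated to $\vec n$ is the monic polynomial $P_{\vec n}=e_{|\vec n|}+\sum_{k=0}^{|\vec n|-1}c_ke_k$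 such that $\langle P_{\vec n},x^ty^s\rangle_j=0$ whenever $0\le\pi(t,s)\le n_j-1$, $j=1,\dots,r$. Type I: the bivariate Type I multiple orthogonal polynomials associated to $\vec n$ are polynomials $A_{\vec n,j}=\sum_{k=0}^{n_j-1}c_{k,j}e_k$, $j=1,\dots,r$ (with $A_{\vec n,j}=0$ if $n_j=0$), such that $\sum_{j=1}^r\langle A_{\vec n,j},x^ty^s\rangle_j$ equals $0$ if $0\le\pi(t,s)\le|\vec n|-2$ and $1$ if $\pi(t,s)=|\vec n|-1$. The bivariate Type I function is $Q_{\vec n}=\sum_{j=1}^rA_{\vec n,j}w_j$ (so $Q_{\vec 0}=0$). A multi-index $\vec n$ is normal if $P_{\vec n}$ exists and is unique; equivalently, if the $A_{\vec n,j}$ exist and are unique; equivalently, if the $|\vec n|\times|\vec n|$ matrix $\left(M^{(1)}_{n_1}|\cdots|M^{(r)}_{n_r}\right)$ is regular, where $M^{(j)}_{n_j}$ is the $|\vec n|\times n_j$ matrix with $(k,l)$ entry (from $0$) $\int e_ke_l\,d\mu_j$. A system of measures is perfect if every $\vec n\in\mathbb{N}^r$ is normal. A path of neighbour multi-indices is a sequence of multi-indices in $\mathbb{N}^r$ in which each term is obtained from the previous one by adding a unit vector $\vec e_j$ for some $j\in\{1,\dots,r\}$.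
   Formalization: The printed leading coefficient 1 fails in boundary cases (e.g. |n|=3 in (1), |n|=4 in (2)); here the leading term is present only if the remainder k_n is at least 1 in (1), at least 2 in (2), and is 0 otherwise. *)

theory Defs
  imports "HOL-Analysis.Analysis" "HOL-Library.Nat_Bijection"
begin

text \<open>Measures \<open>\<mu>\<^sub>1, \<dots>, \<mu>\<^sub>r\<close> and multi-indices are indexed by a finite type \<open>'r\<close>, so that
  \<open>r = CARD('r)\<close>.  Bivariate polynomials are represented by the functions on \<open>real \<times> real\<close>
  that they define, always as explicit combinations of the monomials \<open>e\<^sub>k\<close>; over the reals this
  loses nothing, since distinct polynomials define distinct functions.\<close>

definition cantor_pair :: "nat \<times> nat \<Rightarrow> nat" where
  "cantor_pair = (\<lambda>(t, s). (t + s) * (t + s + 1) div 2 + s)"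

lemma cantor_pair_eq_prod_encode: "cantor_pair (t, s) = prod_encode (s, t)"
  by (simp add: cantor_pair_def prod_encode_def triangle_def add.commute)

lemma bij_cantor_pair: "bij cantor_pair"
proof -
  have "cantor_pair = prod_encode \<circ> prod.swap"
    by (auto simp: fun_eq_iff cantor_pair_eq_prod_encode)
  then show ?thesis
    using bij_comp[OF bij_swap bij_prod_encode] by simp
qed

definition bimonom :: "nat \<Rightarrow> nat \<Rightarrow> real \<times> real \<Rightarrow> real" where
  "bimonom t s = (\<lambda>(x, y). x ^ t * y ^ s)"

definition e_mon :: "nat \<Rightarrow> real \<times> real \<Rightarrow> real" where
  "e_mon k = (case inv cantor_pair k of (t, s) \<Rightarrow> bimonom t s)"

definition msize :: "('r::finite \<Rightarrow> nat) \<Rightarrow> nat" where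
  "msize n = (\<Sum>j\<in>UNIV. n j)"

definition mdegree :: "('r::finite \<Rightarrow> nat) \<Rightarrow> nat" where
  "mdegree n = (case inv cantor_pair (msize n) of (l, m) \<Rightarrow> l + m)"

text \<open>Let \<open>d\<close> be the degree and \<open>k\<close> the remainder of \<open>n\<close>.  The remainder decides whether
  multiplication by \<open>x\<close> or \<open>y\<close> reaches the normalised moment of the Type I function: with
  \<open>i = |n| - d - 1\<close>, \<open>x e\<^sub>i = e\<^bsub>|n|-1\<^esub>\<close> if \<open>1 \<le> k\<close>, but \<open>x e\<^sub>i = e\<^bsub>|n|-2\<^esub>\<close> if
  \<open>k = 0\<close>; with \<open>i = |n| - d - 2\<close>, \<open>y e\<^sub>i = e\<^bsub>|n|-1\<^esub>\<close> if \<open>2 \<le> k\<close>, but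
  \<open>y e\<^sub>i = e\<^bsub>|n|-2\<^esub>\<close> if \<open>k \<le> 1\<close> (whenever \<open>0 \<le> i\<close>).  Hence the leading coefficient of
  the recurrence for \<open>x Q\<^sub>n\<close> is 1 or 0 according to \<open>1 \<le> k\<close> or not, and that of the recurrence for
  \<open>y Q\<^sub>n\<close> is 1 or 0 according to \<open>2 \<le> k\<close> or not.\<close>

definition mremainder :: "('r::finite \<Rightarrow> nat) \<Rightarrow> nat" where
  "mremainder n = msize n - mdegree n * (mdegree n + 1) div 2"

lemma mremainder_eq: "mremainder n = snd (inv cantor_pair (msize n))"
proof -
  obtain l m where lm: "inv cantor_pair (msize n) = (l, m)"
    by force
  then have "cantor_pair (l, m) = msize n"
    by (metis bij_cantor_pair bij_inv_eq_iff)
  then show ?thesis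
    using lm by (simp add: mremainder_def mdegree_def cantor_pair_def)
qed

definition inner_wrt ::
  "(real \<times> real) measure \<Rightarrow> (real \<times> real \<Rightarrow> real) \<Rightarrow> (real \<times> real \<Rightarrow> real) \<Rightarrow> real" where
  "inner_wrt M f g = (\<integral>p. f p * g p \<partial>M)"

definition finite_moments :: "(real \<times> real) measure \<Rightarrow> bool" where
  "finite_moments M \<longleftrightarrow> (\<forall>t s. integrable M (bimonom t s))"

definition is_type_II ::
  "('r::finite \<Rightarrow> (real \<times> real) measure) \<Rightarrow> ('r \<Rightarrow> nat) \<Rightarrow> (real \<times> real \<Rightarrow> real) \<Rightarrow> bool" where
  "is_type_II \<mu>s n P \<longleftrightarrow>
     (\<exists>c. P = (\<lambda>p. e_mon (msize n) p + (\<Sum>k<msize n. c k * e_mon k p))) \<and>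
     (\<forall>j t s. cantor_pair (t, s) < n j \<longrightarrow> inner_wrt (\<mu>s j) P (bimonom t s) = 0)"

definition is_type_I ::
  "('r::finite \<Rightarrow> (real \<times> real) measure) \<Rightarrow> ('r \<Rightarrow> nat) \<Rightarrow> ('r \<Rightarrow> real \<times> real \<Rightarrow> real) \<Rightarrow> bool"
  where
  "is_type_I \<mu>s n A \<longleftrightarrow>
     (\<forall>j. \<exists>c. A j = (\<lambda>p. \<Sum>k<n j. c k * e_mon k p)) \<and>
     (\<forall>t s. (cantor_pair (t, s) + 2 \<le> msize n \<longrightarrow>
               (\<Sum>j\<in>UNIV. inner_wrt (\<mu>s j) (A j) (bimonom t s)) = 0) \<and>
            (cantor_pair (t, s) + 1 = msize n \<longrightarrow>
               (\<Sum>j\<in>UNIV. inner_wrt (\<mu>s j) (A j) (bimonom t s)) = 1))"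

definition normal_index ::
  "('r::finite \<Rightarrow> (real \<times> real) measure) \<Rightarrow> ('r \<Rightarrow> nat) \<Rightarrow> bool" where
  "normal_index \<mu>s n \<longleftrightarrow> (\<exists>!P. is_type_II \<mu>s n P)"

definition perfect_system :: "('r::finite \<Rightarrow> (real \<times> real) measure) \<Rightarrow> bool" where
  "perfect_system \<mu>s \<longleftrightarrow> (\<forall>n. normal_index \<mu>s n)"

text \<open>The two definite descriptions below are only meaningful for normal indices, where
  existence and uniqueness hold.\<close>

definition type_II_poly ::
  "('r::finite \<Rightarrow> (real \<times> real) measure) \<Rightarrow> ('r \<Rightarrow> nat) \<Rightarrow> real \<times> real \<Rightarrow> real" where
  "type_II_poly \<mu>s n = (THE P. is_type_II \<mu>s n P)"

definition type_I_polys ::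
  "('r::finite \<Rightarrow> (real \<times> real) measure) \<Rightarrow> ('r \<Rightarrow> nat) \<Rightarrow> 'r \<Rightarrow> real \<times> real \<Rightarrow> real" where
  "type_I_polys \<mu>s n = (THE A. is_type_I \<mu>s n A)"

definition type_I_fun ::
  "('r::finite \<Rightarrow> (real \<times> real) measure) \<Rightarrow> ('r \<Rightarrow> real \<times> real \<Rightarrow> real) \<Rightarrow> ('r \<Rightarrow> nat) \<Rightarrow>
     real \<times> real \<Rightarrow> real" where
  "type_I_fun \<mu>s w n p = (\<Sum>j\<in>UNIV. type_I_polys \<mu>s n j p * w j p)"

text \<open>The system is given by densities: \<open>d\<mu>\<^sub>j = w\<^sub>j d\<mu>\<close> with \<open>w\<^sub>j\<close> nonnegative almost
  everywhere.  The dominating measure \<open>\<mu>\<close> itself need not have finite moments (it may, for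
  instance, be Lebesgue measure).\<close>

definition measure_system ::
  "(real \<times> real) measure \<Rightarrow> ('r::finite \<Rightarrow> (real \<times> real) measure) \<Rightarrow>
     ('r \<Rightarrow> real \<times> real \<Rightarrow> real) \<Rightarrow> bool" where
  "measure_system \<mu> \<mu>s w \<longleftrightarrow>
     sets \<mu> = sets borel \<and>
     (\<forall>j. w j \<in> borel_measurable borel \<and> (AE p in \<mu>. 0 \<le> w j p) \<and>
          \<mu>s j = density \<mu> (\<lambda>p. ennreal (w j p)) \<and>
          absolutely_continuous \<mu> (\<mu>s j) \<and> finite_moments (\<mu>s j))"

text \<open>Paths are indexed by integers, because \<open>|n| - (d + 1)\<close> can be negative; since
  \<open>|m\<^sub>k| = k\<close>, there is no path starting at a negative index.  The values of \<open>m\<close> outside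
  \<open>{lo..hi}\<close> are irrelevant.\<close>

definition neighbour_path :: "int \<Rightarrow> int \<Rightarrow> (int \<Rightarrow> 'r::finite \<Rightarrow> nat) \<Rightarrow> bool" where
  "neighbour_path lo hi m \<longleftrightarrow>
     (\<forall>k\<in>{lo..hi}. int (msize (m k)) = k) \<and>
     (\<forall>k\<in>{lo..<hi}. \<exists>j. m (k + 1) = (m k)(j := m k j + 1))"

end

theory Submission
  imports Defs "HOL-Computational_Algebra.Polynomial"
begin

text \<open>The proof works with tuples \<open>A\<close> of polynomials instead of the functions
  \<open>\<Sum>\<^sub>j A\<^sub>j w\<^sub>j\<close>, and with the pairing \<open>\<langle>A, f\<rangle> = \<Sum>\<^sub>j \<langle>A\<^sub>j, f\<rangle>\<^sub>j\<close>, which is the integral of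
  \<open>(\<Sum>\<^sub>j A\<^sub>j w\<^sub>j) f\<close> with respect to \<open>\<mu>\<close>.  Let \<open>V\<^sub>n\<close> be the space of tuples whose
  \<open>j\<close>-th entry is a combination of the first \<open>n\<^sub>j\<close> monomials.

  Two facts carry the argument.  First, in a perfect system a tuple in \<open>V\<^sub>n\<close> is determined by its
  pairings with the first \<open>|n|\<close> monomials, and these may be prescribed
  (\<open>type_I_space_eq_0\<close>, \<open>ex_type_I_space\<close>).  In particular the Type I polynomials exist and are
  unique; this transposes the definition of normality, which speaks of Type II polynomials.  No
  matrix is transposed: both claims go by induction on \<open>n\<close>, one unit vector at a time, and the
  step needs only that \<open>P\<^sub>n\<close> is not orthogonal to the next monomial in any direction \<open>j\<close>
  (\<open>inner_wrt_type_II_poly_neq_0\<close>).  Secondly, along a path the Type I tuples and the Type II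
  polynomials are biorthogonal up to a shift of the index: the pairing of the tuple of \<open>m\<^sub>k\<close>
  with the polynomial of \<open>m\<^sub>l\<close> is 1 if \<open>k = l + 1\<close> and 0 otherwise.

  Now multiply the Type I tuple of \<open>n\<close> by \<open>x\<close>.  This moves \<open>e\<^sub>k\<close> to the next antidiagonal,
  hence raises the index by \<open>deg e\<^sub>k + 1 \<le> d + 1\<close>, so that the product lies in \<open>V\<close> of the last
  index of the path.  Its pairing with \<open>e\<^sub>k\<close> is the pairing of the original tuple with
  \<open>x e\<^sub>k\<close>, which vanishes when \<open>x e\<^sub>k\<close> comes before \<open>e\<^bsub>|n|-1\<^esub>\<close>.  Among the
  \<open>e\<^sub>k\<close> below the start of the path, only the last one can be sent to \<open>e\<^bsub>|n|-1\<^esub>\<close>, with pairing 1;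
  the remainder decides whether it is (\<open>shift_hits_last_iff\<close>).  Subtracting the
  Type I tuples of the path with the coefficients suggested by biorthogonality leaves a tuple that
  pairs to zero with every monomial below the size of the last index, hence zero
  (\<open>expansion_along_path\<close>).  Multiplication by \<open>y\<close> is the same, with a shift larger by
  one.\<close>

section \<open>Monomials in the Cantor order\<close>

definition e_degree :: "nat \<Rightarrow> nat" where
  "e_degree k = (case inv cantor_pair k of (t, s) \<Rightarrow> t + s)"

lemma e_mon_cantor_pair [simp]: "e_mon (cantor_pair (t, s)) = bimonom t s"
  by (simp add: e_mon_def bij_is_inj[OF bij_cantor_pair])

lemma e_degree_cantor_pair [simp]: "e_degree (cantor_pair (t, s)) = t + s"
  by (simp add: e_degree_def bij_is_inj[OF bij_cantor_pair])

lemma cantor_pair_cases [case_names pair]: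
  obtains t s where "k = cantor_pair (t, s)"
proof -
  obtain q where "k = cantor_pair q"
    using bij_is_surj[OF bij_cantor_pair] by (rule surjE)
  then show thesis
    using that by (cases q) simp
qed

lemma cantor_pair_eq: "cantor_pair (t, s) = triangle (t + s) + s"
  by (simp add: cantor_pair_def triangle_def)

lemma triangle_mono: "d \<le> d' \<Longrightarrow> triangle d \<le> triangle d'"
  by (induction d' rule: dec_induct) auto

lemma e_degree_bounds: "triangle (e_degree k) \<le> k" "k < triangle (Suc (e_degree k))"
proof -
  obtain t s where k: "k = cantor_pair (t, s)"
    by (rule cantor_pair_cases)
  then have "e_degree k = t + s" "k = triangle (t + s) + s"
    by (simp, simp only: cantor_pair_eq)
  then show "triangle (e_degree k) \<le> k" "k < triangle (Suc (e_degree k))"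
    by simp_all
qed

lemma e_degree_mono: "k \<le> l \<Longrightarrow> e_degree k \<le> e_degree l"
  using e_degree_bounds[of k] e_degree_bounds[of l] triangle_mono[of "Suc (e_degree l)" "e_degree k"]
  by linarith

lemma e_degree_eqI:
  assumes "triangle d \<le> k" "k < triangle (Suc d)"
  shows "e_degree k = d"
proof (rule antisym)
  show "e_degree k \<le> d"
    using assms e_degree_bounds[of k] triangle_mono[of "Suc d" "e_degree k"] by linarith
  show "d \<le> e_degree k"
    using assms e_degree_bounds[of k] triangle_mono[of "Suc (e_degree k)" d] by linarith
qed

text \<open>Multiplication by \<open>x\<close> or \<open>y\<close> moves a monomial to the next antidiagonal.  It passes the
  rest of its own antidiagonal and the start of the next one: \<open>x\<close> keeps the position within the
  antidiagonal, \<open>y\<close> advances it by one.\<close>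

lemma fst_mult_e_mon: "fst p * e_mon k p = e_mon (k + e_degree k + 1) p"
proof (cases k rule: cantor_pair_cases)
  case (pair t s)
  have "k + e_degree k + 1 = cantor_pair (Suc t, s)"
    by (simp add: pair) (simp add: cantor_pair_eq)
  then show ?thesis
    by (simp add: pair bimonom_def split: prod.splits)
qed

lemma snd_mult_e_mon: "snd p * e_mon k p = e_mon (k + e_degree k + 2) p"
proof (cases k rule: cantor_pair_cases)
  case (pair t s)
  have "k + e_degree k + 2 = cantor_pair (t, Suc s)"
    by (simp add: pair) (simp add: cantor_pair_eq)
  then show ?thesis
    by (simp add: pair bimonom_def split: prod.splits)
qed

lemma e_mon_mult: "\<exists>m. (\<lambda>p. e_mon k p * e_mon l p) = e_mon m"
proof (cases k rule: cantor_pair_cases)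
  case k: (pair t s)
  show ?thesis
  proof (cases l rule: cantor_pair_cases)
    case l: (pair t' s')
    have "(\<lambda>p. e_mon k p * e_mon l p) = e_mon (cantor_pair (t + t', s + s'))"
      by (auto simp: k l bimonom_def power_add)
    then show ?thesis by blast
  qed
qed

section \<open>Bivariate polynomials\<close>

text \<open>The number \<open>N\<close> counts the available monomials in the Cantor order; it does not bound the
  total degree.\<close>

definition bipoly :: "nat \<Rightarrow> (real \<times> real \<Rightarrow> real) \<Rightarrow> bool" where
  "bipoly N f \<longleftrightarrow> (\<exists>c. f = (\<lambda>p. \<Sum>k<N. c k * e_mon k p))"

lemma bipolyE:
  assumes "bipoly N f"
  obtains c where "f = (\<lambda>p. \<Sum>k<N. c k * e_mon k p)"
  using assms unfolding bipoly_def by blast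

lemma bipoly_0: "bipoly N (\<lambda>p. 0)"
  unfolding bipoly_def by (rule exI[of _ "\<lambda>_. 0"]) simp

lemma bipoly_add: "bipoly N f \<Longrightarrow> bipoly N g \<Longrightarrow> bipoly N (\<lambda>p. f p + g p)"
  unfolding bipoly_def
proof (elim exE, goal_cases)
  case (1 c c')
  then show ?case
    by (intro exI[of _ "\<lambda>k. c k + c' k"]) (simp add: sum.distrib algebra_simps)
qed

lemma bipoly_scale: "bipoly N f \<Longrightarrow> bipoly N (\<lambda>p. a * f p)"
  unfolding bipoly_def
proof (elim exE, goal_cases)
  case (1 c)
  then show ?case
    by (intro exI[of _ "\<lambda>k. a * c k"]) (simp add: sum_distrib_left mult.assoc)
qed

lemma bipoly_e_mon: "k < N \<Longrightarrow> bipoly N (e_mon k)"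
  unfolding bipoly_def
  by (rule exI[of _ "\<lambda>i. if i = k then 1 else 0"])
     (simp add: fun_eq_iff if_distrib[of "\<lambda>x. x * _"] cong: if_cong)

lemma bipoly_sum:
  assumes "\<And>k. k \<in> K \<Longrightarrow> bipoly N (f k)"
  shows "bipoly N (\<lambda>p. \<Sum>k\<in>K. f k p)"
  using assms by (induction K rule: infinite_finite_induct) (auto intro: bipoly_0 bipoly_add)

lemma bipoly_mono:
  assumes "bipoly N f" "N \<le> M"
  shows "bipoly M f"
proof -
  obtain c where "f = (\<lambda>p. \<Sum>k<N. c k * e_mon k p)"
    using assms(1) by (rule bipolyE)
  then show ?thesis
    using assms(2) by (auto intro!: bipoly_sum bipoly_scale bipoly_e_mon)
qed

lemma bipoly_Suc:
  assumes "bipoly (Suc N) f"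
  obtains g c where "bipoly N g" "f = (\<lambda>p. g p + c * e_mon N p)"
proof -
  obtain c where f: "f = (\<lambda>p. \<Sum>k<Suc N. c k * e_mon k p)"
    using assms by (rule bipolyE)
  show thesis
    by (rule that[of "\<lambda>p. \<Sum>k<N. c k * e_mon k p" "c N"]) (auto simp: f bipoly_def)
qed

lemma bipoly_shift:
  assumes f: "bipoly N f" and u: "\<And>k p. u p * e_mon k p = e_mon (\<sigma> k) p"
    and le: "\<And>k. k < N \<Longrightarrow> \<sigma> k < M"
  shows "bipoly M (\<lambda>p. u p * f p)"
proof -
  obtain c where c: "f = (\<lambda>p. \<Sum>k<N. c k * e_mon k p)"
    using f by (rule bipolyE)
  have "(\<lambda>p. u p * f p) = (\<lambda>p. \<Sum>k<N. c k * e_mon (\<sigma> k) p)"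
    by (simp add: c sum_distrib_left mult.left_commute u)
  then show ?thesis
    by (simp only:) (intro bipoly_sum bipoly_scale bipoly_e_mon, simp add: le)
qed

text \<open>The monomials are linearly independent as functions.  Along the curve
  \<open>(T\<^sup>M, T\<^bsup>M+1\<^esup>)\<close> the monomial \<open>x\<^sup>t y\<^sup>s\<close> becomes \<open>T\<close> to the power \<open>M (t + s) + s\<close>; for
  \<open>M\<close> larger than all \<open>s\<close> that occur these exponents are distinct, and the claim reduces to
  univariate polynomials.\<close>

lemma monic_neq_0:
  assumes f: "bipoly N f" and eq: "\<And>p. e_mon N p + f p = 0"
  shows False
proof -
  obtain c where c: "f = (\<lambda>p. \<Sum>k<N. c k * e_mon k p)"
    using f by (rule bipolyE)
  define M where "M = N + 1"
  define a where "a k = (case inv cantor_pair k of (t, s) \<Rightarrow> M * (t + s) + s)" for k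
  have a_pair: "a (cantor_pair (t, s)) = M * (t + s) + s" for t s
    by (simp add: a_def bij_is_inj[OF bij_cantor_pair])
  have e: "e_mon k (T ^ M, T ^ (M + 1)) = T ^ a k" for k T
    by (cases k rule: cantor_pair_cases)
       (simp add: a_pair bimonom_def power_mult[symmetric] power_add[symmetric] algebra_simps)
  have neq: "a k \<noteq> a N" if "k < N" for k
  proof
    assume eq: "a k = a N"
    obtain t s where k: "k = cantor_pair (t, s)" by (rule cantor_pair_cases)
    obtain t' s' where N: "N = cantor_pair (t', s')" by (rule cantor_pair_cases)
    have "s < M" "s' < M"
      using that k N by (auto simp: M_def cantor_pair_eq)
    moreover have digit: "(M * q + i) mod M = i" "(M * q + i) div M = q" if "i < M" for q i
      using that by simp_all
    ultimately have "a k mod M = s" "a N mod M = s'" "a k div M = t + s" "a N div M = t' + s'"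
      using digit by (simp_all only: k N a_pair)
    then show False
      using eq that k N by auto
  qed
  define q where "q = monom 1 (a N) + (\<Sum>k<N. monom (c k) (a k))"
  have "poly q T = 0" for T
  proof -
    have "T ^ a N + (\<Sum>k<N. c k * T ^ a k) = 0"
      using eq[of "(T ^ M, T ^ (M + 1))"] by (simp only: c e)
    then show ?thesis
      by (simp add: q_def poly_sum poly_monom)
  qed
  then have "q = 0"
    using poly_all_0_iff_0 by blast
  moreover have "coeff q (a N) = 1"
    using neq by (auto simp: q_def coeff_sum intro!: sum.neutral)
  ultimately show False by simp
qed

section \<open>Multi-indices\<close>

lemma msize_step [simp]: "msize (n(j := Suc (n j))) = Suc (msize n)"
proof -
  have "msize (n(j := Suc (n j))) = (\<Sum>i\<in>UNIV. n i + (if i = j then 1 else 0))"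
    unfolding msize_def by (intro sum.cong) auto
  then show ?thesis
    by (simp add: msize_def sum.distrib)
qed

lemma multi_index_induct [case_names zero step]:
  assumes "P (\<lambda>_. 0)" "\<And>n j. P n \<Longrightarrow> P (n(j := Suc (n j)))"
  shows "P (n :: 'r::finite \<Rightarrow> nat)"
proof (induction "msize n" arbitrary: n)
  case 0
  then have "n = (\<lambda>_. 0)" by (auto simp: msize_def)
  then show ?case using assms(1) by simp
next
  case (Suc N)
  obtain j where j: "n j \<noteq> 0"
    using Suc.hyps(2) by (metis msize_def nat.distinct(1) sum.neutral)
  define n' where "n' = n(j := n j - 1)"
  have n: "n = n'(j := Suc (n' j))" using j by (auto simp: n'_def)
  then have "msize n' = N" using Suc.hyps(2) by simp
  then show ?case using Suc.hyps(1)[of n'] assms(2)[of n' j] n by simp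
qed

lemma neighbour_path_mono:
  assumes path: "neighbour_path lo hi m" and "lo \<le> k" "k \<le> l" "l \<le> hi"
  shows "m k j \<le> m l j"
  using \<open>k \<le> l\<close> \<open>l \<le> hi\<close>
proof (induction l rule: int_ge_induct)
  case (step l)
  then obtain i where "m (l + 1) = (m l)(i := m l i + 1)"
    using path \<open>lo \<le> k\<close> unfolding neighbour_path_def by fastforce
  then show ?case using step by (auto intro: le_SucI)
qed simp

section \<open>The pairing of tuples of polynomials with polynomials\<close>

text \<open>The integral of a Type I function against \<open>f\<close>, written without the dominating measure and
  the densities.\<close>

definition pairing ::
  "('r::finite \<Rightarrow> (real \<times> real) measure) \<Rightarrow> ('r \<Rightarrow> real \<times> real \<Rightarrow> real) \<Rightarrow>
     (real \<times> real \<Rightarrow> real) \<Rightarrow> real" where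
  "pairing \<mu>s A f = (\<Sum>j\<in>UNIV. inner_wrt (\<mu>s j) (A j) f)"

definition type_I_space :: "('r::finite \<Rightarrow> nat) \<Rightarrow> ('r \<Rightarrow> real \<times> real \<Rightarrow> real) \<Rightarrow> bool" where
  "type_I_space n A \<longleftrightarrow> (\<forall>j. bipoly (n j) (A j))"

lemma inner_wrt_commute: "inner_wrt M f h = inner_wrt M h f"
  unfolding inner_wrt_def by (simp add: mult.commute)

lemma inner_wrt_scale: "inner_wrt M (\<lambda>p. a * f p) h = a * inner_wrt M f h"
  unfolding inner_wrt_def by (simp add: mult.assoc)

lemma pairing_scale: "pairing \<mu>s (\<lambda>j p. a * A j p) h = a * pairing \<mu>s A h"
  unfolding pairing_def by (simp add: inner_wrt_scale sum_distrib_left)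

lemma pairing_shift:
  assumes u: "\<And>k p. u p * e_mon k p = e_mon (\<sigma> k) p"
  shows "pairing \<mu>s (\<lambda>j p. u p * A j p) (e_mon k) = pairing \<mu>s A (e_mon (\<sigma> k))"
proof -
  have "u p * A j p * e_mon k p = A j p * e_mon (\<sigma> k) p" for j p
    using u[of p k] by (simp add: mult_ac flip: u)
  then show ?thesis by (simp only: pairing_def inner_wrt_def)
qed

lemma type_I_spaceD: "type_I_space n A \<Longrightarrow> bipoly (n j) (A j)"
  by (simp add: type_I_space_def)

lemma type_I_space_mono: "type_I_space n A \<Longrightarrow> (\<And>j. n j \<le> n' j) \<Longrightarrow> type_I_space n' A"
  by (auto simp: type_I_space_def intro: bipoly_mono)

lemma type_I_space_add:
  "type_I_space n A \<Longrightarrow> type_I_space n B \<Longrightarrow> type_I_space n (\<lambda>j p. A j p + B j p)"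
  by (auto simp: type_I_space_def intro: bipoly_add)

lemma type_I_space_scale: "type_I_space n A \<Longrightarrow> type_I_space n (\<lambda>j p. a * A j p)"
  by (auto simp: type_I_space_def intro: bipoly_scale)

lemma type_I_space_sum:
  "(\<And>k. k \<in> K \<Longrightarrow> type_I_space n (A k)) \<Longrightarrow> type_I_space n (\<lambda>j p. \<Sum>k\<in>K. A k j p)"
  by (auto simp: type_I_space_def intro: bipoly_sum)

lemma is_type_I_iff:
  "is_type_I \<mu>s n A \<longleftrightarrow> type_I_space n A \<and>
     (\<forall>k<msize n. pairing \<mu>s A (e_mon k) = (if k + 1 = msize n then 1 else 0))"
proof -
  have "(\<forall>k<msize n. pairing \<mu>s A (e_mon k) = (if k + 1 = msize n then 1 else 0)) \<longleftrightarrow>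
    (\<forall>t s. cantor_pair (t, s) < msize n \<longrightarrow>
      pairing \<mu>s A (bimonom t s) = (if cantor_pair (t, s) + 1 = msize n then 1 else 0))"
    by (metis cantor_pair_cases e_mon_cantor_pair)
  also have "\<dots> \<longleftrightarrow>
    (\<forall>t s. (cantor_pair (t, s) + 2 \<le> msize n \<longrightarrow> pairing \<mu>s A (bimonom t s) = 0) \<and>
           (cantor_pair (t, s) + 1 = msize n \<longrightarrow> pairing \<mu>s A (bimonom t s) = 1))"
  proof -
    have "(k < N \<longrightarrow> v = (if k + 1 = N then 1 else 0)) \<longleftrightarrow>
        (k + 2 \<le> N \<longrightarrow> v = 0) \<and> (k + 1 = N \<longrightarrow> v = 1)" for k N :: nat and v :: real
      by auto
    then show ?thesis by simp
  qed
  finally show ?thesis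
    unfolding is_type_I_def type_I_space_def bipoly_def pairing_def by simp
qed

lemma is_type_II_iff:
  "is_type_II \<mu>s n P \<longleftrightarrow>
     (\<exists>f. bipoly (msize n) f \<and> P = (\<lambda>p. e_mon (msize n) p + f p)) \<and>
     (\<forall>j. \<forall>k<n j. inner_wrt (\<mu>s j) P (e_mon k) = 0)"
proof -
  have "(\<forall>k<N. inner_wrt M P (e_mon k) = 0) \<longleftrightarrow>
    (\<forall>t s. cantor_pair (t, s) < N \<longrightarrow> inner_wrt M P (bimonom t s) = 0)" for N M
    by (metis cantor_pair_cases e_mon_cantor_pair)
  then show ?thesis
    unfolding is_type_II_def bipoly_def by auto
qed

locale moment_system =
  fixes \<mu>s :: "'r::finite \<Rightarrow> (real \<times> real) measure"
  assumes moments: "finite_moments (\<mu>s j)"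
begin

lemma integrable_e_mon: "integrable (\<mu>s j) (e_mon k)"
  using moments[of j] unfolding finite_moments_def
  by (metis cantor_pair_cases e_mon_cantor_pair)

text \<open>Products of monomials are monomials, so finite moments give all the integrability that the
  bilinearity of the pairing requires.\<close>

lemma integrable_bipoly_mult:
  assumes "bipoly N f" "bipoly M g"
  shows "integrable (\<mu>s j) (\<lambda>p. f p * g p)"
proof -
  obtain c where f: "f = (\<lambda>p. \<Sum>k<N. c k * e_mon k p)" using assms(1) by (rule bipolyE)
  obtain d where g: "g = (\<lambda>p. \<Sum>k<M. d k * e_mon k p)" using assms(2) by (rule bipolyE)
  have ee: "integrable (\<mu>s j) (\<lambda>p. e_mon k p * e_mon l p)" for k l
    using e_mon_mult[of k l] integrable_e_mon[of j] by metis
  have "(\<lambda>p. f p * g p) = (\<lambda>p. \<Sum>k<N. \<Sum>l<M. (c k * d l) * (e_mon k p * e_mon l p))"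
    by (simp add: f g sum_product mult_ac)
  then show ?thesis
    by (simp only:) (intro Bochner_Integration.integrable_sum integrable_mult_right ee)
qed

lemma inner_wrt_add:
  "bipoly N f \<Longrightarrow> bipoly M g \<Longrightarrow> bipoly L h \<Longrightarrow>
   inner_wrt (\<mu>s j) (\<lambda>p. f p + g p) h = inner_wrt (\<mu>s j) f h + inner_wrt (\<mu>s j) g h"
  unfolding inner_wrt_def by (simp add: distrib_right integrable_bipoly_mult)

lemma inner_wrt_bipoly_eq_0:
  assumes "bipoly N f" "bipoly M h" "\<And>k. k < N \<Longrightarrow> inner_wrt (\<mu>s j) (e_mon k) h = 0"
  shows "inner_wrt (\<mu>s j) f h = 0"
proof -
  obtain c where f: "f = (\<lambda>p. \<Sum>k<N. c k * e_mon k p)" using assms(1) by (rule bipolyE)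
  have "inner_wrt (\<mu>s j) f h = (\<Sum>k<N. c k * inner_wrt (\<mu>s j) (e_mon k) h)"
    using integrable_bipoly_mult[OF bipoly_e_mon[OF lessI] assms(2)]
    by (simp add: inner_wrt_def f sum_distrib_right mult.assoc)
  then show ?thesis using assms(3) by simp
qed

lemma pairing_add:
  assumes "type_I_space n A" "type_I_space n' B" "bipoly L h"
  shows "pairing \<mu>s (\<lambda>j p. A j p + B j p) h = pairing \<mu>s A h + pairing \<mu>s B h"
  unfolding pairing_def
  by (simp add: inner_wrt_add[OF type_I_spaceD[OF assms(1)] type_I_spaceD[OF assms(2)] assms(3)]
      sum.distrib)

lemma pairing_sum:
  assumes "\<And>k. k \<in> K \<Longrightarrow> type_I_space n (A k)" "bipoly L h"
  shows "pairing \<mu>s (\<lambda>j p. \<Sum>k\<in>K. A k j p) h = (\<Sum>k\<in>K. pairing \<mu>s (A k) h)"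
  using assms(1)
proof (induction K rule: infinite_finite_induct)
  case (insert x F)
  then have "pairing \<mu>s (\<lambda>j p. A x j p + (\<Sum>k\<in>F. A k j p)) h =
      pairing \<mu>s (A x) h + pairing \<mu>s (\<lambda>j p. \<Sum>k\<in>F. A k j p) h"
    by (intro pairing_add[of n _ n _ L] type_I_space_sum assms(2)) auto
  then show ?case using insert by simp
qed (simp_all add: pairing_def inner_wrt_def)

lemma pairing_add_right:
  assumes "type_I_space n A" "bipoly N f" "bipoly M g"
  shows "pairing \<mu>s A (\<lambda>p. f p + g p) = pairing \<mu>s A f + pairing \<mu>s A g"
proof -
  have "inner_wrt (\<mu>s j) (A j) (\<lambda>p. f p + g p) =
      inner_wrt (\<mu>s j) (A j) f + inner_wrt (\<mu>s j) (A j) g" for j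
    using inner_wrt_add[OF assms(2,3) type_I_spaceD[OF assms(1)], of j j]
    by (simp only: inner_wrt_commute[of _ "A j"])
  then show ?thesis
    by (simp add: pairing_def sum.distrib)
qed

lemma pairing_bipoly_eq_0:
  assumes A: "type_I_space n A" and "bipoly N f" "\<And>k. k < N \<Longrightarrow> pairing \<mu>s A (e_mon k) = 0"
  shows "pairing \<mu>s A f = 0"
proof -
  obtain c where f: "f = (\<lambda>p. \<Sum>k<N. c k * e_mon k p)" using assms(2) by (rule bipolyE)
  have *: "integrable (\<mu>s j) (\<lambda>p. A j p * e_mon k p)" for j k
    by (rule integrable_bipoly_mult[OF type_I_spaceD[OF A] bipoly_e_mon[OF lessI]])
  have "inner_wrt (\<mu>s j) (A j) f = (\<Sum>k<N. c k * inner_wrt (\<mu>s j) (A j) (e_mon k))" for j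
    using * by (simp add: inner_wrt_def f sum_distrib_left mult.left_commute[of _ "c _"])
  then have "pairing \<mu>s A f = (\<Sum>k<N. c k * pairing \<mu>s A (e_mon k))"
    unfolding pairing_def by (simp add: sum.swap[of _ UNIV] sum_distrib_left)
  then show ?thesis using assms(3) by simp
qed

end

section \<open>Type I and Type II polynomials of a perfect system\<close>

locale perfect_moment_system = moment_system +
  assumes perfect: "perfect_system \<mu>s"
begin

lemma is_type_II_type_II_poly: "is_type_II \<mu>s n (type_II_poly \<mu>s n)"
  unfolding type_II_poly_def
  using perfect unfolding perfect_system_def normal_index_def by (metis theI')

lemma type_II_poly_unique: "is_type_II \<mu>s n P \<Longrightarrow> P = type_II_poly \<mu>s n"
  using is_type_II_type_II_poly[of n] perfect
  unfolding perfect_system_def normal_index_def by blast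

lemma type_II_poly_monic:
  obtains f where "bipoly (msize n) f" "type_II_poly \<mu>s n = (\<lambda>p. e_mon (msize n) p + f p)"
  using is_type_II_type_II_poly[of n] unfolding is_type_II_iff by blast

lemma bipoly_type_II_poly: "bipoly (Suc (msize n)) (type_II_poly \<mu>s n)"
proof -
  obtain f where f: "bipoly (msize n) f" "type_II_poly \<mu>s n = (\<lambda>p. e_mon (msize n) p + f p)"
    by (rule type_II_poly_monic)
  then have "bipoly (Suc (msize n)) f"
    by (intro bipoly_mono[OF f(1)]) simp
  then show ?thesis
    unfolding f(2) by (intro bipoly_add bipoly_e_mon[OF lessI])
qed

lemma pairing_type_II_poly_eq_0:
  assumes "type_I_space n A"
  shows "pairing \<mu>s A (type_II_poly \<mu>s n) = 0"
proof -
  have "inner_wrt (\<mu>s j) (A j) (type_II_poly \<mu>s n) = 0" for j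
    using is_type_II_type_II_poly[of n]
    by (intro inner_wrt_bipoly_eq_0[OF type_I_spaceD[OF assms] bipoly_type_II_poly])
       (auto simp: is_type_II_iff inner_wrt_commute)
  then show ?thesis by (simp add: pairing_def)
qed

text \<open>\<open>P\<^sub>n\<close> is monic, and \<open>A\<close> does not see its lower terms.\<close>

lemma pairing_type_II_poly:
  assumes A: "type_I_space n' A" and low: "\<And>k. k < msize n \<Longrightarrow> pairing \<mu>s A (e_mon k) = 0"
  shows "pairing \<mu>s A (type_II_poly \<mu>s n) = pairing \<mu>s A (e_mon (msize n))"
proof -
  obtain f where f: "bipoly (msize n) f" "type_II_poly \<mu>s n = (\<lambda>p. e_mon (msize n) p + f p)"
    by (rule type_II_poly_monic)
  have "pairing \<mu>s A f = 0"
    by (rule pairing_bipoly_eq_0[OF A f(1) low])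
  then show ?thesis
    using pairing_add_right[OF A bipoly_e_mon[OF lessI] f(1)] f(2) by simp
qed

text \<open>Otherwise \<open>P\<^sub>n\<close> would satisfy all orthogonality conditions of the neighbour of \<open>n\<close> in
  direction \<open>j\<close>.  Adding \<open>P\<^sub>n\<close>, which is not the zero function, to the Type II polynomial of that
  neighbour keeps its leading term and so would give a second one.\<close>

lemma inner_wrt_type_II_poly_neq_0: "inner_wrt (\<mu>s j) (e_mon (n j)) (type_II_poly \<mu>s n) \<noteq> 0"
proof
  assume 0: "inner_wrt (\<mu>s j) (e_mon (n j)) (type_II_poly \<mu>s n) = 0"
  define n' where "n' = n(j := Suc (n j))"
  let ?P = "type_II_poly \<mu>s n" and ?P' = "type_II_poly \<mu>s n'"
  have size: "msize n' = Suc (msize n)" by (simp add: n'_def)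
  obtain f where f: "bipoly (msize n) f" "?P = (\<lambda>p. e_mon (msize n) p + f p)"
    by (rule type_II_poly_monic)
  obtain f' where f': "bipoly (msize n') f'" "?P' = (\<lambda>p. e_mon (msize n') p + f' p)"
    by (rule type_II_poly_monic)
  have "inner_wrt (\<mu>s i) ?P (e_mon k) = 0" if "k < n' i" for i k
    using that 0 is_type_II_type_II_poly[of n] less_Suc_eq
    by (auto simp: is_type_II_iff n'_def inner_wrt_commute[of _ ?P] split: if_splits)
  moreover have "inner_wrt (\<mu>s i) ?P' (e_mon k) = 0" if "k < n' i" for i k
    using that is_type_II_type_II_poly[of n'] by (simp add: is_type_II_iff)
  ultimately have "is_type_II \<mu>s n' (\<lambda>p. ?P' p + ?P p)"
    unfolding is_type_II_iff
    using inner_wrt_add[OF bipoly_type_II_poly[of n'] bipoly_type_II_poly[of n] bipoly_e_mon[OF lessI]]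
      bipoly_add[OF f'(1), of ?P] bipoly_type_II_poly[of n]
    by (auto simp: size f'(2) add.assoc)
  then have "(\<lambda>p. ?P' p + ?P p) = ?P'"
    by (rule type_II_poly_unique)
  then have "e_mon (msize n) p + f p = 0" for p
    using f(2) by (auto dest: fun_cong[of _ _ p])
  then show False
    using monic_neq_0[OF f(1)] by blast
qed

text \<open>If \<open>n\<close> is raised by one in entry \<open>i\<close>, pairing a tuple for the new index with \<open>P\<^sub>n\<close> isolates
  the top coefficient of its \<open>i\<close>-th entry: everything else is orthogonal to \<open>P\<^sub>n\<close>.
  Since the pairing is zero, so is this coefficient, and the tuple already belongs to \<open>n\<close>.\<close>

lemma type_I_space_eq_0:
  assumes "type_I_space n A" "\<And>k. k < msize n \<Longrightarrow> pairing \<mu>s A (e_mon k) = 0"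
  shows "A j p = 0"
  using assms
proof (induction n arbitrary: A j p rule: multi_index_induct)
  case zero
  then have "bipoly 0 (A j)"
    using type_I_spaceD[of "\<lambda>_. 0" A j] by simp
  then show ?case by (auto simp: bipoly_def)
next
  case (step n i)
  let ?n' = "n(i := Suc (n i))" and ?P = "type_II_poly \<mu>s n"
  have "bipoly (Suc (n i)) (A i)"
    using type_I_spaceD[OF step.prems(1), of i] by simp
  then obtain g c where g: "bipoly (n i) g" "A i = (\<lambda>p. g p + c * e_mon (n i) p)"
    by (rule bipoly_Suc)
  let ?B = "A(i := g)"
  have B: "type_I_space n ?B"
    unfolding type_I_space_def
  proof
    fix l
    show "bipoly (n l) (?B l)"
      using g(1) type_I_spaceD[OF step.prems(1), of l] by (cases "l = i") auto
  qed
  have "pairing \<mu>s A ?P = pairing \<mu>s ?B ?P + c * inner_wrt (\<mu>s i) (e_mon (n i)) ?P"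
  proof -
    have "inner_wrt (\<mu>s i) (A i) ?P = inner_wrt (\<mu>s i) g ?P + c * inner_wrt (\<mu>s i) (e_mon (n i)) ?P"
      unfolding g(2)
      by (subst inner_wrt_add[OF g(1) bipoly_scale[OF bipoly_e_mon[OF lessI]] bipoly_type_II_poly])
         (simp add: inner_wrt_scale)
    moreover have "pairing \<mu>s C ?P =
        inner_wrt (\<mu>s i) (C i) ?P + (\<Sum>l\<in>UNIV - {i}. inner_wrt (\<mu>s l) (C l) ?P)" for C
      unfolding pairing_def by (rule sum.remove) auto
    moreover have "(\<Sum>l\<in>UNIV - {i}. inner_wrt (\<mu>s l) (?B l) ?P) =
        (\<Sum>l\<in>UNIV - {i}. inner_wrt (\<mu>s l) (A l) ?P)"
      by (intro sum.cong) auto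
    ultimately show ?thesis by simp
  qed
  moreover have "pairing \<mu>s A ?P = 0"
  proof (rule pairing_bipoly_eq_0[OF step.prems(1) bipoly_type_II_poly])
    show "pairing \<mu>s A (e_mon k) = 0" if "k < Suc (msize n)" for k
      by (rule step.prems(2)) (simp only: msize_step that)
  qed
  ultimately have "c = 0"
    using pairing_type_II_poly_eq_0[OF B] inner_wrt_type_II_poly_neq_0[of i n] by simp
  then have "?B = A"
    using g(2) by (auto simp: fun_eq_iff)
  then have "type_I_space n A"
    using B by simp
  then show ?case
    by (rule step.IH) (rule step.prems(2), simp only: msize_step less_SucI)
qed

text \<open>To raise entry \<open>i\<close> of \<open>n\<close> by one, a tuple with the right pairings below \<open>|n|\<close> is corrected
  by a multiple of a tuple \<open>C\<close> that pairs to zero with the monomials below \<open>|n|\<close> but not with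
  \<open>e\<^bsub>|n|\<^esub>\<close>.\<close>

lemma ex_type_I_space:
  "\<exists>A. type_I_space n A \<and> (\<forall>k<msize n. pairing \<mu>s A (e_mon k) = \<phi> k)"
proof (induction n arbitrary: \<phi> rule: multi_index_induct)
  case zero
  then show ?case by (auto simp: type_I_space_def msize_def intro: bipoly_0)
next
  case (step n i)
  let ?n' = "n(i := Suc (n i))" and ?N = "msize n"
  have size: "msize ?n' = Suc ?N" by simp
  have up: "type_I_space n A \<Longrightarrow> type_I_space ?n' A" for A
    by (erule type_I_space_mono) simp
  \<comment> \<open>\<open>C\<close> is the new monomial, placed in entry \<open>i\<close>, minus the tuple for \<open>n\<close> with the same
    lower pairings, so \<open>\<langle>C, e\<^bsub>|n|\<^esub>\<rangle> = \<langle>C, P\<^sub>n\<rangle> = \<langle>e\<^bsub>n i\<^esub>, P\<^sub>n\<rangle>\<^sub>i\<close>.\<close>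
  define E where "E = (\<lambda>j p. if j = i then e_mon (n i) p else 0)"
  have E: "type_I_space ?n' E"
    by (auto simp: type_I_space_def E_def bipoly_0 bipoly_e_mon)
  have pE: "pairing \<mu>s E h = inner_wrt (\<mu>s i) (e_mon (n i)) h" for h
    unfolding pairing_def by (subst sum.remove[of _ i]) (auto simp: E_def inner_wrt_def intro!: sum.neutral)
  have e: "bipoly (Suc k) (e_mon k)" for k by (rule bipoly_e_mon[OF lessI])
  obtain B where B: "type_I_space n B" "\<forall>k<?N. pairing \<mu>s B (e_mon k) = - pairing \<mu>s E (e_mon k)"
    using step.IH[of "\<lambda>k. - pairing \<mu>s E (e_mon k)"] by blast
  define C where "C = (\<lambda>j p. E j p + B j p)"
  have C: "type_I_space ?n' C"
    unfolding C_def by (intro type_I_space_add E up B)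
  have C0: "pairing \<mu>s C (e_mon k) = 0" if "k < ?N" for k
    using that B(2) pairing_add[OF E B(1) e] by (simp add: C_def)
  have "pairing \<mu>s C (e_mon ?N) = pairing \<mu>s C (type_II_poly \<mu>s n)"
    by (rule pairing_type_II_poly[OF C C0, symmetric])
  also have "\<dots> = inner_wrt (\<mu>s i) (e_mon (n i)) (type_II_poly \<mu>s n)"
    using pairing_add[OF E B(1) bipoly_type_II_poly] pairing_type_II_poly_eq_0[OF B(1)]
    by (simp add: C_def pE)
  finally have CN: "pairing \<mu>s C (e_mon ?N) \<noteq> 0"
    using inner_wrt_type_II_poly_neq_0 by simp
  obtain A where A: "type_I_space n A" "\<forall>k<?N. pairing \<mu>s A (e_mon k) = \<phi> k"
    using step.IH[of \<phi>] by blast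
  define a where "a = (\<phi> ?N - pairing \<mu>s A (e_mon ?N)) / pairing \<mu>s C (e_mon ?N)"
  have "pairing \<mu>s (\<lambda>j p. A j p + a * C j p) (e_mon k) = \<phi> k" if "k < Suc ?N" for k
  proof -
    have "pairing \<mu>s (\<lambda>j p. A j p + a * C j p) (e_mon k) =
        pairing \<mu>s A (e_mon k) + a * pairing \<mu>s C (e_mon k)"
      by (simp only: pairing_add[OF A(1) type_I_space_scale[OF C] e] pairing_scale)
    moreover have "a * pairing \<mu>s C (e_mon ?N) = \<phi> ?N - pairing \<mu>s A (e_mon ?N)"
      using CN by (simp add: a_def)
    ultimately show ?thesis
      using that A(2) C0 by (cases "k = ?N") auto
  qed
  moreover have "type_I_space ?n' (\<lambda>j p. A j p + a * C j p)"
    by (intro type_I_space_add type_I_space_scale up A C)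
  ultimately show ?case unfolding size by blast
qed

lemma is_type_I_type_I_polys: "is_type_I \<mu>s n (type_I_polys \<mu>s n)"
proof -
  obtain A where A: "is_type_I \<mu>s n A"
    using ex_type_I_space[of n "\<lambda>k. if k + 1 = msize n then 1 else 0"]
    unfolding is_type_I_iff by blast
  have "B = A" if B: "is_type_I \<mu>s n B" for B
  proof (intro ext)
    fix j p
    have spaces: "type_I_space n A" "type_I_space n B"
      using A B by (simp_all add: is_type_I_iff)
    have "B j p + (- 1) * A j p = 0"
    proof (rule type_I_space_eq_0[where A = "\<lambda>j p. B j p + (- 1) * A j p"])
      show "type_I_space n (\<lambda>j p. B j p + (- 1) * A j p)"
        by (intro type_I_space_add type_I_space_scale spaces)
      show "pairing \<mu>s (\<lambda>j p. B j p + (- 1) * A j p) (e_mon k) = 0" if "k < msize n" for k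
      proof -
        have "pairing \<mu>s (\<lambda>j p. B j p + (- 1) * A j p) (e_mon k) =
            pairing \<mu>s B (e_mon k) + (- 1) * pairing \<mu>s A (e_mon k)"
          by (simp only: pairing_scale pairing_add[OF spaces(2) type_I_space_scale[OF spaces(1)]
                bipoly_e_mon[OF lessI]])
        then show ?thesis
          using A B that by (simp add: is_type_I_iff)
      qed
    qed
    then show "B j p = A j p" by simp
  qed
  then show ?thesis
    unfolding type_I_polys_def using A by (metis theI)
qed

lemma type_I_space_type_I_polys: "type_I_space n (type_I_polys \<mu>s n)"
  using is_type_I_type_I_polys[of n] by (simp add: is_type_I_iff)

lemma pairing_type_I_polys:
  "k < msize n \<Longrightarrow>
   pairing \<mu>s (type_I_polys \<mu>s n) (e_mon k) = (if k + 1 = msize n then 1 else 0)"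
  using is_type_I_type_I_polys[of n] by (simp add: is_type_I_iff)

text \<open>For \<open>k \<le> l\<close> this is the orthogonality of \<open>P\<close>, because \<open>m\<^sub>k \<le> m\<^sub>l\<close> entrywise; for
  \<open>k > l\<close> it is that of the Type I tuple, because \<open>P\<close> is monic with leading index \<open>l < k\<close>.\<close>

lemma biorthogonality:
  assumes path: "neighbour_path lo hi m" and k: "k \<in> {lo..hi}" and l: "l \<in> {lo..hi}"
  shows "pairing \<mu>s (type_I_polys \<mu>s (m k)) (type_II_poly \<mu>s (m l)) = (if k = l + 1 then 1 else 0)"
proof (cases "k \<le> l")
  case True
  then have "type_I_space (m l) (type_I_polys \<mu>s (m k))"
    using k l by (intro type_I_space_mono[OF type_I_space_type_I_polys]
        neighbour_path_mono[OF path]) auto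
  then show ?thesis using True by (simp add: pairing_type_II_poly_eq_0)
next
  case False
  have size: "int (msize (m k)) = k" "int (msize (m l)) = l"
    using path k l by (auto simp: neighbour_path_def)
  then have "pairing \<mu>s (type_I_polys \<mu>s (m k)) (type_II_poly \<mu>s (m l)) =
      pairing \<mu>s (type_I_polys \<mu>s (m k)) (e_mon (msize (m l)))"
    using False
    by (intro pairing_type_II_poly[OF type_I_space_type_I_polys]) (auto simp: pairing_type_I_polys)
  then show ?thesis using False size by (auto simp: pairing_type_I_polys)
qed

text \<open>The coefficients from \<open>lo + 1\<close> on are read off from biorthogonality.  The one at \<open>lo\<close> comes
  from the pairings below \<open>lo\<close>: there the tuple looks like \<open>\<beta>\<close> times the Type I tuple of
  \<open>m lo\<close>.  The difference of the two sides then pairs to zero with all monomials below \<open>hi\<close>.\<close>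

lemma expansion_along_path:
  assumes path: "neighbour_path lo hi m" and "lo \<le> hi"
    and A: "type_I_space (m hi) A"
    and low: "\<And>i. int i < lo \<Longrightarrow> pairing \<mu>s A (e_mon i) = (if int i + 1 = lo then \<beta> else 0)"
  shows "A j p = \<beta> * type_I_polys \<mu>s (m lo) j p +
    (\<Sum>k = lo + 1..hi. pairing \<mu>s A (type_II_poly \<mu>s (m (k - 1))) * type_I_polys \<mu>s (m k) j p)"
proof -
  define a where "a k = pairing \<mu>s A (type_II_poly \<mu>s (m (k - 1)))" for k
  let ?T = "\<lambda>k. type_I_polys \<mu>s (m k)" and ?K = "{lo + 1..hi}"
  define S where "S = (\<lambda>j p. \<Sum>k\<in>?K. a k * ?T k j p)"
  define L where "L = (\<lambda>j p. \<beta> * ?T lo j p)"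
  define R where "R = (\<lambda>j p. A j p + (- 1) * (L j p + S j p))"
  have size: "int (msize (m k)) = k" if "k \<in> {lo..hi}" for k
    using path that by (simp add: neighbour_path_def)
  have T: "type_I_space (m hi) (?T k)" if "k \<in> {lo..hi}" for k
    using that by (intro type_I_space_mono[OF type_I_space_type_I_polys]
        neighbour_path_mono[OF path]) auto
  have aT: "type_I_space (m hi) (\<lambda>j p. a k * ?T k j p)" if "k \<in> ?K" for k
    using that by (intro type_I_space_scale T) auto
  have S: "type_I_space (m hi) S"
    unfolding S_def using aT by (rule type_I_space_sum)
  have L: "type_I_space (m hi) L"
    unfolding L_def using \<open>lo \<le> hi\<close> by (intro type_I_space_scale T) auto
  have R: "type_I_space (m hi) R"
    unfolding R_def by (intro type_I_space_add type_I_space_scale A L S)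
  have pR: "pairing \<mu>s R h = pairing \<mu>s A h - (\<beta> * pairing \<mu>s (?T lo) h +
      (\<Sum>k\<in>?K. a k * pairing \<mu>s (?T k) h))" if h: "bipoly M h" for h M
  proof -
    have "pairing \<mu>s S h = (\<Sum>k\<in>?K. a k * pairing \<mu>s (?T k) h)"
      unfolding S_def by (subst pairing_sum[OF aT h]) (simp_all add: pairing_scale)
    moreover have "pairing \<mu>s L h = \<beta> * pairing \<mu>s (?T lo) h"
      unfolding L_def by (rule pairing_scale)
    ultimately show ?thesis
      unfolding R_def
      by (simp only: pairing_add[OF A type_I_space_scale[OF type_I_space_add[OF L S]] h]
          pairing_add[OF L S h] pairing_scale) simp
  qed
  \<comment> \<open>Below \<open>lo\<close> by the hypothesis; from \<open>lo\<close> on, biorthogonality gives zero pairing with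
    \<open>P\<close>, whose leading monomial is the only one not yet treated.\<close>
  have "pairing \<mu>s R (e_mon i) = 0" if "i < msize (m hi)" for i
    using that
  proof (induction i rule: less_induct)
    case (less i)
    have i: "int i < hi" using less.prems size[of hi] \<open>lo \<le> hi\<close> by simp
    show ?case
    proof (cases "int i < lo")
      case True
      have "pairing \<mu>s (?T k) (e_mon i) = 0" if "k \<in> ?K" for k
      proof -
        have "int (msize (m k)) = k" using that by (intro size) auto
        then show ?thesis using that True by (subst pairing_type_I_polys) auto
      qed
      moreover have "pairing \<mu>s (?T lo) (e_mon i) = (if int i + 1 = lo then 1 else 0)"
      proof -
        have "int (msize (m lo)) = lo" using \<open>lo \<le> hi\<close> by (intro size) auto
        then show ?thesis using True by (subst pairing_type_I_polys) auto
      qed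
      ultimately show ?thesis
        using low[OF True] by (subst pR[OF bipoly_e_mon[OF lessI]]) simp
    next
      case False
      let ?l = "int i"
      have l: "?l \<in> {lo..hi}" using False i by simp
      have sz: "msize (m ?l) = i" using size[OF l] by simp
      have "(\<Sum>k\<in>?K. a k * pairing \<mu>s (?T k) (type_II_poly \<mu>s (m ?l))) =
          (\<Sum>k\<in>?K. if k = ?l + 1 then a k else 0)"
        using l by (intro sum.cong refl) (simp add: biorthogonality[OF path])
      also have "\<dots> = a (?l + 1)"
        using False i by (simp add: sum.delta')
      finally have "pairing \<mu>s R (type_II_poly \<mu>s (m ?l)) = 0"
        using False l \<open>lo \<le> hi\<close>
        by (subst pR[OF bipoly_type_II_poly]) (simp add: biorthogonality[OF path] a_def)
      moreover have "pairing \<mu>s R (type_II_poly \<mu>s (m ?l)) = pairing \<mu>s R (e_mon (msize (m ?l)))"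
        using less sz by (intro pairing_type_II_poly[OF R]) auto
      ultimately show ?thesis using sz by simp
    qed
  qed
  then have "R j p = 0"
    by (rule type_I_space_eq_0[OF R])
  then show ?thesis
    by (simp add: R_def L_def S_def a_def)
qed

end

section \<open>Recurrence relations\<close>

lemma inner_wrt_density_sum:
  assumes ms: "measure_system \<mu> \<mu>s w" and A: "type_I_space n A" and h: "bipoly N h"
  shows "inner_wrt \<mu> (\<lambda>p. \<Sum>j\<in>UNIV. A j p * w j p) h = pairing \<mu>s A h"
proof -
  interpret moment_system \<mu>s
    using ms unfolding measure_system_def by unfold_locales blast
  have "w j \<in> borel_measurable borel" "sets \<mu> = sets borel" for j
    using ms unfolding measure_system_def by (blast, blast)
  then have meas_w: "w j \<in> borel_measurable \<mu>" for j
    using measurable_cong_sets by blast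
  have w: "w j \<in> borel_measurable \<mu>" "AE p in \<mu>. 0 \<le> w j p"
    "\<mu>s j = density \<mu> (\<lambda>p. ennreal (w j p))" for j
    using ms meas_w unfolding measure_system_def by (blast, blast, blast)
  have int: "integrable (\<mu>s j) (\<lambda>p. A j p * h p)" for j
    by (rule integrable_bipoly_mult[OF type_I_spaceD[OF A] h])
  then have meas: "(\<lambda>p. A j p * h p) \<in> borel_measurable \<mu>" for j
    using borel_measurable_integrable[OF int[of j]] by (simp add: w(3))
  have "integrable \<mu> (\<lambda>p. w j p * (A j p * h p))" for j
    using int[of j] integrable_density[OF meas[of j] w(1,2)[of j]] by (simp add: w(3))
  moreover have "inner_wrt (\<mu>s j) (A j) h = (\<integral>p. w j p * (A j p * h p) \<partial>\<mu>)" for j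
    using integral_density[OF meas[of j] w(1,2)[of j]] by (simp add: inner_wrt_def w(3))
  ultimately show ?thesis
    unfolding pairing_def
    by (simp add: inner_wrt_def sum_distrib_left mult_ac)
qed

text \<open>Both recurrences are instances: \<open>u\<close> is the coordinate function and \<open>\<sigma>\<close> its action on the
  indices of the monomials.  The condition \<open>B\<close> says that \<open>u\<close> sends the last monomial below
  \<open>lo\<close> to the monomial with normalised moment.\<close>

lemma type_I_fun_recurrence:
  fixes n :: "'r::finite \<Rightarrow> nat" and D :: nat and lo hi :: int
  assumes ms: "measure_system \<mu> \<mu>s w" and perfect: "perfect_system \<mu>s"
    and u: "\<And>k p. u p * e_mon k p = e_mon (\<sigma> k) p"
    and up: "\<And>k. k < msize n \<Longrightarrow> \<sigma> k < k + D + 1"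
    and down: "\<And>k. int k < lo \<Longrightarrow> \<sigma> k < msize n \<and> (\<sigma> k + 1 = msize n \<longleftrightarrow> int k + 1 = lo \<and> B)"
    and path: "neighbour_path lo hi m" and "lo \<le> hi" and final: "m hi = (\<lambda>j. n j + D)"
    and a: "\<And>k. k \<in> {lo..hi - 1} \<Longrightarrow>
       a (k + 1) = inner_wrt \<mu> (\<lambda>p. u p * type_I_fun \<mu>s w n p) (type_II_poly \<mu>s (m k))"
  shows "u p * type_I_fun \<mu>s w n p =
    (if B then type_I_fun \<mu>s w (m lo) p else 0) + (\<Sum>k = lo + 1..hi. a k * type_I_fun \<mu>s w (m k) p)"
proof -
  interpret perfect_moment_system \<mu>s
    using ms perfect unfolding measure_system_def by unfold_locales blast+
  define A where "A = (\<lambda>j p. u p * type_I_polys \<mu>s n j p)"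
  have le: "n j \<le> msize n" for j
    unfolding msize_def by (rule member_le_sum) auto
  have A: "type_I_space (m hi) A"
    unfolding type_I_space_def A_def final
  proof
    fix j
    show "bipoly (n j + D) (\<lambda>p. u p * type_I_polys \<mu>s n j p)"
    proof (rule bipoly_shift[OF type_I_spaceD[OF type_I_space_type_I_polys] u])
      fix k
      assume "k < n j"
      then show "\<sigma> k < n j + D"
        using up[of k] le[of j] by linarith
    qed
  qed
  have uQ: "u p * type_I_fun \<mu>s w n p = (\<Sum>j\<in>UNIV. A j p * w j p)" for p
    by (simp add: type_I_fun_def A_def sum_distrib_left mult.assoc)
  have a': "a k = pairing \<mu>s A (type_II_poly \<mu>s (m (k - 1)))" if "k \<in> {lo + 1..hi}" for k
    using a[of "k - 1"] that inner_wrt_density_sum[OF ms A bipoly_type_II_poly]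
    by (simp add: uQ)
  define \<beta> :: real where "\<beta> = (if B then 1 else 0)"
  have low: "pairing \<mu>s A (e_mon i) = (if int i + 1 = lo then \<beta> else 0)" if "int i < lo" for i
    unfolding A_def pairing_shift[OF u] using down[OF that]
    by (auto simp: pairing_type_I_polys \<beta>_def)
  have "A j p = \<beta> * type_I_polys \<mu>s (m lo) j p +
      (\<Sum>k = lo + 1..hi. a k * type_I_polys \<mu>s (m k) j p)" for j
  proof -
    have "(\<Sum>k = lo + 1..hi. a k * type_I_polys \<mu>s (m k) j p) =
        (\<Sum>k = lo + 1..hi. pairing \<mu>s A (type_II_poly \<mu>s (m (k - 1))) * type_I_polys \<mu>s (m k) j p)"
      by (intro sum.cong) (simp_all only: a')
    then show ?thesis
      using expansion_along_path[OF path \<open>lo \<le> hi\<close> A low, of j p] by (simp only:)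
  qed
  then have "(\<Sum>j\<in>UNIV. A j p * w j p) = \<beta> * type_I_fun \<mu>s w (m lo) p +
      (\<Sum>k = lo + 1..hi. a k * type_I_fun \<mu>s w (m k) p)"
    unfolding type_I_fun_def
    by (simp add: distrib_right sum.distrib sum_distrib_left sum_distrib_right mult.assoc
        sum.swap[of _ UNIV])
  then show ?thesis
    by (simp add: uQ \<beta>_def)
qed

lemma mdegree_eq_e_degree: "mdegree n = e_degree (msize n)"
  by (simp add: mdegree_def e_degree_def)

lemma msize_eq_triangle_mremainder: "msize n = triangle (mdegree n) + mremainder n"
  using e_degree_bounds(1)[of "msize n"]
  by (simp add: mremainder_def mdegree_eq_e_degree triangle_def)

lemma mremainder_le: "mremainder n \<le> mdegree n"
proof -
  have "msize n < triangle (mdegree n) + Suc (mdegree n)"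
    using e_degree_bounds(2)[of "msize n"] by (simp add: mdegree_eq_e_degree)
  then show ?thesis
    using msize_eq_triangle_mremainder[of n] by linarith
qed

lemma triangle_pred: "0 < d \<Longrightarrow> triangle d = triangle (d - 1) + d"
  by (cases d) simp_all

text \<open>An index at least \<open>d + s\<close> below \<open>|n|\<close> lies on an antidiagonal before the \<open>d\<close>-th, so the
  shift keeps it below \<open>|n|\<close>.  It reaches \<open>|n| - 1\<close> only from distance exactly \<open>d + s\<close> and
  from the antidiagonal \<open>d - 1\<close>; that position, counted from the start of the antidiagonal
  \<open>d - 1\<close>, is the remainder minus \<open>s\<close>, whence the condition on the remainder.\<close>

lemma shift_hits_last_iff:
  fixes n :: "'r::finite \<Rightarrow> nat"
  assumes s: "1 \<le> s" and le: "k + (mdegree n + s) \<le> msize n"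
  shows "k + e_degree k + s < msize n"
    and "k + e_degree k + s + 1 = msize n \<longleftrightarrow> k + (mdegree n + s) = msize n \<and> s \<le> mremainder n"
proof -
  let ?d = "mdegree n" and ?r = "mremainder n"
  have N: "msize n = triangle ?d + ?r" and r: "?r \<le> ?d"
    by (rule msize_eq_triangle_mremainder, rule mremainder_le)
  have less: "e_degree k < ?d"
  proof (rule ccontr)
    assume "\<not> e_degree k < ?d"
    then have "triangle ?d \<le> k"
      using triangle_mono[of ?d "e_degree k"] e_degree_bounds(1)[of k] by linarith
    then show False using le N r s by linarith
  qed
  then show "k + e_degree k + s < msize n" using le by linarith
  have tri: "triangle ?d = triangle (?d - 1) + ?d"
    using less by (intro triangle_pred) simp
  show "k + e_degree k + s + 1 = msize n \<longleftrightarrow> k + (?d + s) = msize n \<and> s \<le> ?r"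
  proof
    assume eq: "k + e_degree k + s + 1 = msize n"
    then have k: "k + (?d + s) = msize n" "e_degree k = ?d - 1"
      using le less by linarith+
    then have "triangle (?d - 1) \<le> k" using e_degree_bounds(1)[of k] by simp
    then show "k + (?d + s) = msize n \<and> s \<le> ?r" using k(1) N tri by linarith
  next
    assume k: "k + (?d + s) = msize n \<and> s \<le> ?r"
    then have "triangle (?d - 1) \<le> k" using N tri by linarith
    moreover have "k < triangle (Suc (?d - 1))" using k N r s tri less by simp
    ultimately have "e_degree k = ?d - 1" by (rule e_degree_eqI)
    then show "k + e_degree k + s + 1 = msize n" using k less by simp
  qed
qed

lemma shifted_type_I_fun_recurrence:
  fixes n :: "'r::finite \<Rightarrow> nat"
  assumes ms: "measure_system \<mu> \<mu>s w" and perfect: "perfect_system \<mu>s"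
    and u: "\<And>k p. u p * e_mon k p = e_mon (k + e_degree k + s) p" and s: "1 \<le> s"
    and lo: "lo = int (msize n) - int (mdegree n) - int s + 1"
    and hi: "hi = int (msize n) + (int (mdegree n) + int s) * int CARD('r)"
    and path: "neighbour_path lo hi m" and final: "m hi = (\<lambda>j. n j + (mdegree n + s))"
    and a: "\<And>k. k \<in> {lo..hi - 1} \<Longrightarrow>
       a (k + 1) = inner_wrt \<mu> (\<lambda>p. u p * type_I_fun \<mu>s w n p) (type_II_poly \<mu>s (m k))"
  shows "u p * type_I_fun \<mu>s w n p =
    (if s \<le> mremainder n then type_I_fun \<mu>s w (m lo) p else 0) +
    (\<Sum>k = lo + 1..hi. a k * type_I_fun \<mu>s w (m k) p)"
proof (rule type_I_fun_recurrence[OF ms perfect u _ _ path _ final a])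
  show "k + e_degree k + s < k + (mdegree n + s) + 1" if "k < msize n" for k
    using e_degree_mono[of k "msize n"] that by (simp add: mdegree_eq_e_degree)
  show "k + e_degree k + s < msize n \<and>
      (k + e_degree k + s + 1 = msize n \<longleftrightarrow> int k + 1 = lo \<and> s \<le> mremainder n)" if "int k < lo" for k
  proof -
    have le: "k + (mdegree n + s) \<le> msize n"
      using that lo by linarith
    have eq: "k + (mdegree n + s) = msize n \<longleftrightarrow> int k + 1 = lo"
      using lo by linarith
    show ?thesis
      using shift_hits_last_iff[OF s le] unfolding eq by blast
  qed
  have "0 \<le> (int (mdegree n) + int s) * int CARD('r)" by simp
  then show "lo \<le> hi" using s unfolding lo hi by linarith
qed

theorem theorem4p11:
  fixes \<mu> :: "(real \<times> real) measure"
    and \<mu>s :: "'r::finite \<Rightarrow> (real \<times> real) measure"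
    and w :: "'r \<Rightarrow> real \<times> real \<Rightarrow> real"
    and n :: "'r \<Rightarrow> nat"
    and N d r :: int
  assumes "measure_system \<mu> \<mu>s w"
    and "perfect_system \<mu>s"
    and "N = int (msize n)" and "d = int (mdegree n)" and "r = int CARD('r)"
  shows
    "(\<forall>m a. neighbour_path (N - d) (N + (d + 1) * r) m \<and> m N = n \<and>
        m (N + (d + 1) * r) = (\<lambda>j. n j + mdegree n + 1) \<and>
        (\<forall>k\<in>{N - d .. N + (d + 1) * r - 1}.
           a (k + 1) = inner_wrt \<mu> (\<lambda>p. fst p * type_I_fun \<mu>s w n p) (type_II_poly \<mu>s (m k))) \<longrightarrow>
        (\<forall>x y. x * type_I_fun \<mu>s w n (x, y) =
           (if 1 \<le> mremainder n then type_I_fun \<mu>s w (m (N - d)) (x, y) else 0) +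
           (\<Sum>k = N - d + 1 .. N + (d + 1) * r. a k * type_I_fun \<mu>s w (m k) (x, y)))) \<and>
     (\<forall>m b. neighbour_path (N - (d + 1)) (N + (d + 2) * r) m \<and> m N = n \<and>
        m (N + (d + 2) * r) = (\<lambda>j. n j + mdegree n + 2) \<and>
        (\<forall>k\<in>{N - d - 1 .. N + (d + 2) * r - 1}.
           b (k + 1) = inner_wrt \<mu> (\<lambda>p. snd p * type_I_fun \<mu>s w n p) (type_II_poly \<mu>s (m k))) \<longrightarrow>
        (\<forall>x y. y * type_I_fun \<mu>s w n (x, y) =
           (if 2 \<le> mremainder n then type_I_fun \<mu>s w (m (N - (d + 1))) (x, y) else 0) +
           (\<Sum>k = N - d .. N + (d + 2) * r. b k * type_I_fun \<mu>s w (m k) (x, y))))"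
proof (intro conjI allI impI)
  fix m :: "int \<Rightarrow> 'r \<Rightarrow> nat" and a x y
  assume "neighbour_path (N - d) (N + (d + 1) * r) m \<and> m N = n \<and>
        m (N + (d + 1) * r) = (\<lambda>j. n j + mdegree n + 1) \<and>
        (\<forall>k\<in>{N - d .. N + (d + 1) * r - 1}.
           a (k + 1) = inner_wrt \<mu> (\<lambda>p. fst p * type_I_fun \<mu>s w n p) (type_II_poly \<mu>s (m k)))"
  then show "x * type_I_fun \<mu>s w n (x, y) =
           (if 1 \<le> mremainder n then type_I_fun \<mu>s w (m (N - d)) (x, y) else 0) +
           (\<Sum>k = N - d + 1 .. N + (d + 1) * r. a k * type_I_fun \<mu>s w (m k) (x, y))"
    using shifted_type_I_fun_recurrence[OF assms(1,2) fst_mult_e_mon, where p = "(x, y)" and m = m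
        and a = a and lo = "N - d" and hi = "N + (d + 1) * r"] assms(3-5)
    by simp
next
  fix m :: "int \<Rightarrow> 'r \<Rightarrow> nat" and b x y
  assume "neighbour_path (N - (d + 1)) (N + (d + 2) * r) m \<and> m N = n \<and>
        m (N + (d + 2) * r) = (\<lambda>j. n j + mdegree n + 2) \<and>
        (\<forall>k\<in>{N - d - 1 .. N + (d + 2) * r - 1}.
           b (k + 1) = inner_wrt \<mu> (\<lambda>p. snd p * type_I_fun \<mu>s w n p) (type_II_poly \<mu>s (m k)))"
  then show "y * type_I_fun \<mu>s w n (x, y) =
           (if 2 \<le> mremainder n then type_I_fun \<mu>s w (m (N - (d + 1))) (x, y) else 0) +
           (\<Sum>k = N - d .. N + (d + 2) * r. b k * type_I_fun \<mu>s w (m k) (x, y))"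
    using shifted_type_I_fun_recurrence[OF assms(1,2) snd_mult_e_mon, where p = "(x, y)" and m = m
        and a = b and lo = "N - (d + 1)" and hi = "N + (d + 2) * r"] assms(3-5)
    by (simp add: algebra_simps)
qed

end
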